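(* Let $C=\{z\in\mathbb{R}^n: Az-b\in K,\ l\le z\le u\}$, let an $\mathrm{AVI}(C,q,M)$ be given, and let $\mathrm{MCP}(B_1\times B_2,\tilde q,\tilde M)$ be its mixed complementarity reformulation, where $$B_1=\prod_{j=1}^n[l_j,u_j],\quad B_2=\{\lambda\in\mathbb{R}^m:\lambda\in K^D\},\quad \tilde M=\begin{bmatrix} M & -A^T \\ A & 0 \end{bmatrix},\quad\tilde q=\begin{bmatrix} q \\ -b \end{bmatrix}.$$ Then the number of full-dimensional cells of the piecewise-linear $(n+1)$-manifold $\mathcal{M}_C$ is less than or equal to the number of full-dimensional cells of the piecewise-linear $(n+m+1)$-manifold $\mathcal{M}_{B_1\times B_2}$.
   Context: $A\in\mathbb{R}^{m\times n}$ has nonzero rows, $b\in\mathbb{R}^m$, $M\in\mathbb{R}^{n\times n}$, $q\in\mathbb{R}^n$, $l_j,u_j\in\mathbb{R}\cup\{\pm\infty\}$ (with $[l_j,u_j]$ meaning the nonempty closed interval of real numbers between these bounds), and $K=\prod_{i=1}^mK_i$ with each $K_i\in\{\mathbb{R}_+,\{0\},\mathbb{R}_-\}$; $K^D=\{y:\langle y,k\rangle\ge0\ \forall k\in K\}$. $\mathrm{AVI}(C,q,M)$: find $z\in C$ with $\langle Mz+q,y-z\rangle\ge0$ for all $y\in C$. For a box $S=\prod_j[a_j,d_j]$, $\mathrm{MCP}(S,p,H)$ asks for $y\in S$ and $w,v\ge0$ with $Hy+p=w-v$, $(y-a)^Tw=0$, $(d-y)^Tv=0$ (with components of $w$, $v$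 for infinite bounds equal to $0$). For a polyhedral convex set $S\subset\mathbb{R}^k$, the manifold $\mathcal{M}_S$ is the subdivision of $\mathbb{R}^k\times\mathbb{R}_+$ whose full-dimensional (i.e. $(k+1)$-dimensional) cells are the sets $(F+N_F)\times\mathbb{R}_+$, one for each nonempty face $F$ of $S$, where $N_F$ is the constant value of the normal cone $N_S(z)=\{y:\langle y,z'-z\rangle\le0\ \forall z'\in S\}$ for $z\in\operatorname{ri}F$. *)

theory Defs
  imports "HOL-Analysis.Analysis"
begin

definition vec_prod :: "('i::finite \<Rightarrow> real set) \<Rightarrow> (real^'i) set" where
  "vec_prod X = {x. \<forall>i. x $ i \<in> X i}"

definition dual_cone :: "'a::real_inner set \<Rightarrow> 'a set" where
  "dual_cone K = {y. \<forall>k\<in>K. 0 \<le> y \<bullet> k}"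

text \<open>A box contains real vectors only; its bounds may be infinite.\<close>

definition ebox :: "('i::finite \<Rightarrow> ereal) \<Rightarrow> ('i \<Rightarrow> ereal) \<Rightarrow> (real^'i) set" where
  "ebox a d = {x. \<forall>i. a i \<le> ereal (x $ i) \<and> ereal (x $ i) \<le> d i}"

text \<open>Vectors of dimension \<open>n + m\<close> are indexed by the sum type \<open>'n + 'm\<close>.\<close>

definition vec_join :: "'a^'n \<Rightarrow> 'a^'m \<Rightarrow> 'a^('n + 'm)" where
  "vec_join x y = (\<chi> k. case k of Inl j \<Rightarrow> x $ j | Inr i \<Rightarrow> y $ i)"

definition vec_times :: "('a^'n) set \<Rightarrow> ('a^'m) set \<Rightarrow> ('a^('n + 'm)) set" where
  "vec_times X Y = {vec_join x y | x y. x \<in> X \<and> y \<in> Y}"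

definition block_matrix ::
  "'a^'n^'n \<Rightarrow> 'a^'m^'n \<Rightarrow> 'a^'n^'m \<Rightarrow> 'a^'m^'m \<Rightarrow> 'a^('n + 'm)^('n + 'm)" where
  "block_matrix P Q R T =
     (\<chi> k. case k of Inl j \<Rightarrow> vec_join (P $ j) (Q $ j) | Inr i \<Rightarrow> vec_join (R $ i) (T $ i))"

datatype 'n avi =
  AVI (avi_set: "(real^('n::finite)) set") (avi_vec: "real^'n") (avi_mat: "real^'n^'n")

definition avi_solution :: "('n::finite) avi \<Rightarrow> real^'n \<Rightarrow> bool" where
  "avi_solution P z \<longleftrightarrow> z \<in> avi_set P \<and>
     (\<forall>y\<in>avi_set P. 0 \<le> (avi_mat P *v z + avi_vec P) \<bullet> (y - z))"

datatype 'k mcp =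
  MCP (mcp_set: "(real^('k::finite)) set") (mcp_vec: "real^'k") (mcp_mat: "real^'k^'k")

text \<open>
  The bounds \<open>a\<close>, \<open>d\<close> are those of the box underlying the problem (they are unique, as the box
  contains \<open>y\<close>). Since \<^term>\<open>real_of_ereal\<close> maps infinite bounds to \<open>0\<close> and the corresponding
  components of \<open>w\<close> and \<open>v\<close> vanish, infinite bounds do not contribute to the sums.
\<close>

definition mcp_solution :: "('k::finite) mcp \<Rightarrow> real^'k \<Rightarrow> bool" where
  "mcp_solution P y \<longleftrightarrow> y \<in> mcp_set P \<and>
     (\<exists>a d w v. mcp_set P = ebox a d \<and> (\<forall>j. 0 \<le> w $ j) \<and> (\<forall>j. 0 \<le> v $ j) \<and>
        (\<forall>j. \<bar>a j\<bar> = \<infinity> \<longrightarrow> w $ j = 0) \<and> (\<forall>j. \<bar>d j\<bar> = \<infinity> \<longrightarrow> v $ j = 0) \<and>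
        mcp_mat P *v y + mcp_vec P = w - v \<and>
        (\<Sum>j\<in>UNIV. (y $ j - real_of_ereal (a j)) * w $ j) = 0 \<and>
        (\<Sum>j\<in>UNIV. (real_of_ereal (d j) - y $ j) * v $ j) = 0)"

definition normal_cone :: "'a::real_inner set \<Rightarrow> 'a \<Rightarrow> 'a set" where
  "normal_cone S z = {y. \<forall>z'\<in>S. y \<bullet> (z' - z) \<le> 0}"

definition face_normal_cone :: "'a::euclidean_space set \<Rightarrow> 'a set \<Rightarrow> 'a set" where
  "face_normal_cone S F = (THE N. \<forall>z\<in>rel_interior F. normal_cone S z = N)"

text \<open>The value in question exists and is unique, so the description operator is meaningful:\<close>

lemma normal_cone_rel_interior_subset:
  fixes S :: "'a::euclidean_space set"
  assumes "convex F" "F \<subseteq> S" "z \<in> rel_interior F" "w \<in> rel_interior F"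
  shows "normal_cone S z \<subseteq> normal_cone S w"
proof
  fix y assume y: "y \<in> normal_cone S z"
  have "w \<in> F" using assms(4) rel_interior_subset by blast
  then have "w \<in> affine hull F" by (rule hull_inc)
  from bspec[OF convex_rel_interior_if2[OF assms(1,3)] this]
  obtain e where e: "e > 1" and "(1 - e) *\<^sub>R w + e *\<^sub>R z \<in> F"
    by (elim exE conjE)
  from this(2) have eS: "(1 - e) *\<^sub>R w + e *\<^sub>R z \<in> S"
    by (rule subsetD[OF assms(2)])
  have "y \<bullet> ((1 - e) *\<^sub>R w + e *\<^sub>R z - z) \<le> 0"
    using y eS by (simp add: normal_cone_def)
  also have "(1 - e) *\<^sub>R w + e *\<^sub>R z - z = (e - 1) *\<^sub>R (z - w)"
    by (simp add: algebra_simps)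
  finally have zw: "y \<bullet> (z - w) \<le> 0"
    using e by (simp add: mult_le_0_iff)
  show "y \<in> normal_cone S w"
    unfolding normal_cone_def
  proof safe
    fix s assume "s \<in> S"
    then have "y \<bullet> (s - z) \<le> 0" using y by (simp add: normal_cone_def)
    then show "y \<bullet> (s - w) \<le> 0" using zw by (simp add: inner_diff_right)
  qed
qed

lemma face_normal_cone_eq:
  assumes "F face_of S" "z \<in> rel_interior F"
  shows "face_normal_cone S F = normal_cone S z"
proof -
  have *: "normal_cone S w = normal_cone S z" if "w \<in> rel_interior F" for w
    using normal_cone_rel_interior_subset[of F S] face_of_imp_convex[OF assms(1)]
      face_of_imp_subset[OF assms(1)] that assms(2)
    by (simp add: set_eq_subset)
  show ?thesis
    unfolding face_normal_cone_def using * assms(2) by (intro the_equality) blast+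
qed

text \<open>\<open>+\<close> below is the Minkowski sum of sets.\<close>

definition full_cells :: "'a::euclidean_space set \<Rightarrow> ('a \<times> real) set set" where
  "full_cells S = {(F + face_normal_cone S F) \<times> {0..} | F. F face_of S \<and> F \<noteq> {}}"

end

theory Submission
  imports Defs
begin

text \<open>
  A nonempty face \<open>F\<close> of a convex set \<open>S\<close> is recovered from its cell, since
  \<open>S \<inter> (F + N\<^sub>F) = F\<close>; so cells can be replaced by nonempty faces. Faces of \<open>C\<close> are separated by
  the constraints active at a relative interior point. Translating an active bound on \<open>z\<^sub>j\<close> into the
  same bound in \<open>B\<^sub>1\<close>, and an inactive row of \<open>A z - b \<in> K\<close> into \<open>\<lambda>\<^sub>i = 0\<close> in \<open>B\<^sub>2\<close>, maps the
  nonempty faces of \<open>C\<close> injectively to nonempty faces of the box \<open>B\<^sub>1 \<times> B\<^sub>2\<close>.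
\<close>

section \<open>Recovering a face from its cell\<close>

text \<open>Let \<open>s = f + n\<close> lie in \<open>S\<close>, with \<open>n\<close> normal at a
  relative interior point \<open>z\<close> of \<open>F\<close>. Normality gives
  \<open>n \<bullet> (s - z) \<le> 0\<close>, and prolonging the segment from \<open>f\<close>
  beyond \<open>z\<close> inside \<open>F\<close> gives \<open>n \<bullet> (z - f) \<le> 0\<close>.
  The sum is \<open>n \<bullet> n \<le> 0\<close>, hence \<open>s = f\<close>.\<close>

lemma inter_face_plus_normal_cone:
  fixes S :: "'a::euclidean_space set"
  assumes F: "F face_of S" and ne: "F \<noteq> {}"
  shows "S \<inter> (F + face_normal_cone S F) = F"
proof -
  have cvx: "convex F" and FS: "F \<subseteq> S"
    using F by (simp_all add: face_of_imp_convex face_of_imp_subset)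
  obtain z where z: "z \<in> rel_interior F"
    using ne cvx rel_interior_eq_empty by blast
  note N = face_normal_cone_eq[OF F z]
  show ?thesis
  proof (intro subset_antisym subsetI)
    fix s assume "s \<in> S \<inter> (F + face_normal_cone S F)"
    then obtain f n where s: "s \<in> S" and f: "f \<in> F" and n: "n \<in> normal_cone S z" and sfn: "s = f + n"
      by (auto simp: N elim: set_plus_elim)
    have "f \<in> affine hull F" using f by (rule hull_inc)
    then obtain e where e: "e > 1" and eF: "(1 - e) *\<^sub>R f + e *\<^sub>R z \<in> F"
      using convex_rel_interior_if2[OF cvx z] by blast
    have "n \<bullet> ((1 - e) *\<^sub>R f + e *\<^sub>R z - z) \<le> 0"
      using n eF FS by (auto simp: normal_cone_def)
    also have "(1 - e) *\<^sub>R f + e *\<^sub>R z - z = (e - 1) *\<^sub>R (z - f)"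
      by (simp add: algebra_simps)
    finally have "n \<bullet> (z - f) \<le> 0"
      using e by (simp add: mult_le_0_iff)
    moreover have "n \<bullet> (s - z) \<le> 0"
      using n s by (simp add: normal_cone_def)
    ultimately have "n \<bullet> n \<le> 0"
      by (simp add: sfn inner_simps)
    then have "n = 0"
      by (metis inner_ge_zero inner_eq_zero_iff order_antisym)
    then show "s \<in> F" using f sfn by simp
  next
    fix f assume f: "f \<in> F"
    have "f + 0 \<in> F + face_normal_cone S F"
      by (rule set_plus_intro[OF f]) (simp add: N normal_cone_def)
    then show "f \<in> S \<inter> (F + face_normal_cone S F)" using f FS by auto
  qed
qed

lemma full_cells_eq_image:
  "full_cells S = (\<lambda>F. (F + face_normal_cone S F) \<times> {0..}) ` {F. F face_of S \<and> F \<noteq> {}}"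
  by (auto simp: full_cells_def)

lemma inj_on_full_cell:
  fixes S :: "'a::euclidean_space set"
  shows "inj_on (\<lambda>F. (F + face_normal_cone S F) \<times> {0::real..}) {F. F face_of S \<and> F \<noteq> {}}"
proof (rule inj_onI)
  fix F G assume F: "F \<in> {F. F face_of S \<and> F \<noteq> {}}" and G: "G \<in> {F. F face_of S \<and> F \<noteq> {}}"
    and "(F + face_normal_cone S F) \<times> {0::real..} = (G + face_normal_cone S G) \<times> {0..}"
  then have eq: "F + face_normal_cone S F = G + face_normal_cone S G"
    using times_eq_iff by fastforce
  have "F = S \<inter> (F + face_normal_cone S F)"
    using F by (simp add: inter_face_plus_normal_cone)
  also have "\<dots> = G"
    unfolding eq using G by (simp add: inter_face_plus_normal_cone)
  finally show "F = G" .
qed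

lemma card_full_cells: "card (full_cells S) = card {F. F face_of S \<and> F \<noteq> {}}"
  unfolding full_cells_eq_image by (rule card_image[OF inj_on_full_cell])

text \<open>Since \<open>card\<close> is 0 on infinite sets, finiteness is transferred to faces
  alongside the count.\<close>

lemma finite_full_cells_iff: "finite (full_cells S) \<longleftrightarrow> finite {F. F face_of S \<and> F \<noteq> {}}"
  unfolding full_cells_eq_image by (rule finite_image_iff[OF inj_on_full_cell])

section \<open>Comparing faces by prolonging segments\<close>

text \<open>For \<open>w \<noteq> z\<close> the point \<open>z\<close> lies strictly between
  \<open>w\<close> and its prolongation, so the defining property of a face puts both endpoints in
  \<open>F\<close>.\<close>

lemma face_of_extend_mem:
  fixes z w :: "'a::euclidean_space"
  assumes "F face_of S" "z \<in> F" "w \<in> S" "e > 0" "z + e *\<^sub>R (z - w) \<in> S"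
  shows "w \<in> F"
proof (cases "w = z")
  case False
  \<comment> \<open>The point \<open>z\<close> divides the segment from \<open>w\<close> to its
    prolongation in the ratio 1 : \<open>e\<close>, which fixes the weight
    \<open>1 / (1 + e)\<close>.\<close>
  have "z = (1 - 1 / (1 + e)) *\<^sub>R w + (1 / (1 + e)) *\<^sub>R (z + e *\<^sub>R (z - w))"
  proof -
    have "(1 / (1 + e)) *\<^sub>R (z + e *\<^sub>R (z - w)) = (1 / (1 + e)) *\<^sub>R ((1 + e) *\<^sub>R z - e *\<^sub>R w)"
      by (simp add: algebra_simps)
    also have "\<dots> = z - (e / (1 + e)) *\<^sub>R w"
      using \<open>e > 0\<close> by (simp add: scaleR_diff_right)
    also have "e / (1 + e) = 1 - 1 / (1 + e)"
      using \<open>e > 0\<close> by (simp add: field_simps)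
    finally show ?thesis by simp
  qed
  moreover have "w \<noteq> z + e *\<^sub>R (z - w)"
  proof
    assume "w = z + e *\<^sub>R (z - w)"
    then have "(1 + e) *\<^sub>R (z - w) = 0" by (simp add: algebra_simps)
    then show False using False \<open>e > 0\<close> by simp
  qed
  ultimately have "z \<in> open_segment w (z + e *\<^sub>R (z - w))"
    using \<open>e > 0\<close> unfolding in_segment by (intro conjI exI[of _ "1 / (1 + e)"]) auto
  then show ?thesis
    using assms face_ofD by blast
qed (use assms in simp)

text \<open>Prolongation puts \<open>w\<close> in \<open>F\<close>, and a face of \<open>S\<close>
  that meets the relative interior of \<open>G\<close> contains all of \<open>G\<close>.\<close>

lemma face_of_subset_extend:
  fixes z w :: "'a::euclidean_space"
  assumes "F face_of S" "G face_of S" "z \<in> F" "w \<in> rel_interior G" "e > 0" "z + e *\<^sub>R (z - w) \<in> S"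
  shows "G \<subseteq> F"
proof -
  have GS: "G \<subseteq> S" and w: "w \<in> S"
    using assms(2,4) face_of_imp_subset rel_interior_subset by blast+
  then have "w \<in> F"
    using face_of_extend_mem assms by blast
  then show ?thesis
    using subset_of_face_of[OF assms(1) GS] assms(4) by blast
qed

text \<open>A coordinate of \<open>x\<close> at a bound does not move, because \<open>y\<close> sits
  at the same bound. Every other inequality is strict at \<open>x\<close> and survives a small step,
  and there are only finitely many coordinates.\<close>

lemma ebox_extend:
  assumes x: "x \<in> ebox a d" and y: "y \<in> ebox a d"
    and a: "\<And>k. ereal (x $ k) = a k \<Longrightarrow> ereal (y $ k) = a k"
    and d: "\<And>k. ereal (x $ k) = d k \<Longrightarrow> ereal (y $ k) = d k"
  obtains e where "e > 0" "x + e *\<^sub>R (x - y) \<in> ebox a d"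
proof -
  \<comment> \<open>Taking the one-sided limit in \<open>ereal\<close> treats finite and infinite
    bounds alike.\<close>
  have lim: "((\<lambda>e. ereal (x $ k + e * (x $ k - y $ k))) \<longlongrightarrow> ereal (x $ k + 0 * (x $ k - y $ k))) (at_right 0)" for k
    by (intro tendsto_intros)
  have lo: "\<forall>\<^sub>F e in at_right 0. a k \<le> ereal (x $ k + e * (x $ k - y $ k))" for k
  proof (cases "ereal (x $ k) = a k")
    case True
    then have "x $ k = y $ k" using a by (metis ereal.inject)
    then show ?thesis using True by simp
  next
    case False
    then have "a k < ereal (x $ k)" using x by (auto simp: ebox_def order.order_iff_strict)
    from order_tendstoD(1)[OF lim, of "a k" k] this show ?thesis
      by (auto elim: eventually_mono)
  qed
  have hi: "\<forall>\<^sub>F e in at_right 0. ereal (x $ k + e * (x $ k - y $ k)) \<le> d k" for k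
  proof (cases "ereal (x $ k) = d k")
    case True
    then have "x $ k = y $ k" using d by (metis ereal.inject)
    then show ?thesis using True by simp
  next
    case False
    then have "ereal (x $ k) < d k" using x by (auto simp: ebox_def order.order_iff_strict)
    from order_tendstoD(2)[OF lim, of k "d k"] this show ?thesis
      by (auto elim: eventually_mono)
  qed
  have "\<forall>\<^sub>F e in at_right 0. \<forall>k. a k \<le> ereal (x $ k + e * (x $ k - y $ k)) \<and>
      ereal (x $ k + e * (x $ k - y $ k)) \<le> d k"
    by (intro eventually_all_finite eventually_conj lo hi)
  with eventually_at_right_less[of "0::real"]
  have "\<forall>\<^sub>F e in at_right 0. 0 < e \<and> x + e *\<^sub>R (x - y) \<in> ebox a d"
    by eventually_elim (simp add: ebox_def)
  then show ?thesis
    using that eventually_happens'[OF trivial_limit_at_right_real] by blast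
qed

section \<open>Faces of a box\<close>

text \<open>For \<open>y\<close> in the box this is the smallest face containing \<open>y\<close>.
  Within a fixed box it depends only on which bounds are active at \<open>y\<close>.\<close>

definition ebox_face ::
  "('i::finite \<Rightarrow> ereal) \<Rightarrow> ('i \<Rightarrow> ereal) \<Rightarrow> real^'i \<Rightarrow> (real^'i) set" where
  "ebox_face a d y = {x \<in> ebox a d. \<forall>k. (ereal (y $ k) = a k \<longrightarrow> ereal (x $ k) = a k) \<and>
     (ereal (y $ k) = d k \<longrightarrow> ereal (x $ k) = d k)}"

text \<open>A finite bound gives a half-space, an infinite one the whole space or the empty set.
  This supplies convexity and the finiteness of the set of faces.\<close>

lemma polyhedron_ebox: "polyhedron (ebox a d)"
proof -
  have lo: "polyhedron {x::real^'a. a k \<le> ereal (x $ k)}" for k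
  proof (cases "a k")
    case (real r)
    have "{x::real^'a. a k \<le> ereal (x $ k)} = {x. axis k 1 \<bullet> x \<ge> r}"
      by (simp add: real inner_axis')
    then show ?thesis by (simp add: polyhedron_halfspace_ge)
  qed simp_all
  have hi: "polyhedron {x::real^'a. ereal (x $ k) \<le> d k}" for k
  proof (cases "d k")
    case (real r)
    have "{x::real^'a. ereal (x $ k) \<le> d k} = {x. axis k 1 \<bullet> x \<le> r}"
      by (simp add: real inner_axis')
    then show ?thesis by (simp add: polyhedron_halfspace_le)
  qed simp_all
  have "ebox a d = (\<Inter>k. {x. a k \<le> ereal (x $ k)} \<inter> {x. ereal (x $ k) \<le> d k})"
    by (auto simp: ebox_def)
  also have "polyhedron \<dots>"
    by (intro polyhedron_Inter) (auto intro: polyhedron_Int lo hi)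
  finally show ?thesis .
qed

text \<open>A bound active at \<open>y\<close> defines a supporting hyperplane and so cuts out a
  face; an inactive bound leaves the whole box. Intersecting these faces over all bounds gives the
  claim.\<close>

lemma ebox_face_face_of:
  assumes "y \<in> ebox a d"
  shows "ebox_face a d y face_of ebox a d"
proof -
  have cvx: "convex (ebox a d)" by (simp add: polyhedron_ebox polyhedron_imp_convex)
  define L where "L k = {x \<in> ebox a d. ereal (y $ k) = a k \<longrightarrow> ereal (x $ k) = a k}" for k
  define U where "U k = {x \<in> ebox a d. ereal (y $ k) = d k \<longrightarrow> ereal (x $ k) = d k}" for k
  have L: "L k face_of ebox a d" for k
  proof (cases "ereal (y $ k) = a k")
    case True
    have "L k = ebox a d \<inter> {x. axis k 1 \<bullet> x = y $ k}"
      by (auto simp: L_def True[symmetric] inner_axis')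
    moreover have "y $ k \<le> axis k 1 \<bullet> x" if "x \<in> ebox a d" for x
    proof -
      from that have "a k \<le> ereal (x $ k)" by (simp add: ebox_def)
      then show ?thesis by (simp add: True[symmetric] inner_axis')
    qed
    ultimately show ?thesis
      using face_of_Int_supporting_hyperplane_ge[OF cvx] by metis
  qed (simp add: L_def cvx face_of_refl)
  have U: "U k face_of ebox a d" for k
  proof (cases "ereal (y $ k) = d k")
    case True
    have "U k = ebox a d \<inter> {x. axis k 1 \<bullet> x = y $ k}"
      by (auto simp: U_def True[symmetric] inner_axis')
    moreover have "axis k 1 \<bullet> x \<le> y $ k" if "x \<in> ebox a d" for x
    proof -
      from that have "ereal (x $ k) \<le> d k" by (simp add: ebox_def)
      then show ?thesis by (simp add: True[symmetric] inner_axis')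
    qed
    ultimately show ?thesis
      using face_of_Int_supporting_hyperplane_le[OF cvx] by metis
  qed (simp add: U_def cvx face_of_refl)
  have "ebox_face a d y = \<Inter> (range (\<lambda>k. L k \<inter> U k))"
    by (auto simp: ebox_face_def L_def U_def)
  also have "\<dots> face_of ebox a d"
    by (rule face_of_Inter) (auto intro: face_of_Int L U)
  finally show ?thesis .
qed

lemma mem_ebox_face: "y \<in> ebox a d \<Longrightarrow> y \<in> ebox_face a d y"
  by (simp add: ebox_face_def)

text \<open>Each of \<open>y\<close> and \<open>y'\<close> lies in the face of the other, so the
  active bounds can be read back from the face.\<close>

lemma ebox_face_eqD:
  assumes "ebox_face a d y = ebox_face a d y'" "y \<in> ebox a d" "y' \<in> ebox a d"
  shows "ereal (y $ k) = a k \<longleftrightarrow> ereal (y' $ k) = a k" "ereal (y $ k) = d k \<longleftrightarrow> ereal (y' $ k) = d k"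
  using mem_ebox_face[OF assms(2)] mem_ebox_face[OF assms(3)] assms(1)
  by (auto simp: ebox_face_def)

section \<open>Products, cones and dual cones as boxes\<close>

lemma vec_join_nth [simp]: "vec_join x y $ Inl j = x $ j" "vec_join x y $ Inr i = y $ i"
  by (simp_all add: vec_join_def)

lemma vec_join_eta: "x = vec_join (\<chi> j. x $ Inl j) (\<chi> i. x $ Inr i)"
  by (simp add: vec_join_def vec_eq_iff split: sum.split)

lemma all_sum_iff: "(\<forall>k. R k) \<longleftrightarrow> (\<forall>j. R (Inl j)) \<and> (\<forall>i. R (Inr i))"
  by (metis sum.exhaust)

lemma vec_times_ebox:
  "vec_times (ebox a d) (ebox a' d') = ebox (case_sum a a') (case_sum d d')"
proof (intro subset_antisym subsetI)
  fix x assume "x \<in> ebox (case_sum a a') (case_sum d d')"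
  then have "(\<chi> j. x $ Inl j) \<in> ebox a d" "(\<chi> i. x $ Inr i) \<in> ebox a' d'"
    by (simp_all add: ebox_def all_sum_iff)
  then show "x \<in> vec_times (ebox a d) (ebox a' d')"
    unfolding vec_times_def using vec_join_eta[of x] by blast
qed (auto simp: vec_times_def ebox_def all_sum_iff)

text \<open>Testing against \<open>axis i k\<close> isolates one coordinate; this vector lies in the
  product because every factor contains 0.\<close>

lemma dual_cone_vec_prod:
  fixes K :: "'m::finite \<Rightarrow> real set"
  assumes "\<And>i. 0 \<in> K i"
  shows "dual_cone (vec_prod K) = vec_prod (\<lambda>i. dual_cone (K i))"
proof (intro subset_antisym subsetI)
  fix y assume y: "y \<in> dual_cone (vec_prod K)"
  have "0 \<le> y $ i * k" if "k \<in> K i" for i k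
  proof -
    have "axis i k \<in> vec_prod K" using that assms by (simp add: vec_prod_def axis_def)
    then have "0 \<le> y \<bullet> axis i k" using y by (simp add: dual_cone_def)
    then show ?thesis by (simp add: inner_axis)
  qed
  then show "y \<in> vec_prod (\<lambda>i. dual_cone (K i))"
    by (simp add: vec_prod_def dual_cone_def)
next
  fix y assume "y \<in> vec_prod (\<lambda>i. dual_cone (K i))"
  then show "y \<in> dual_cone (vec_prod K)"
    by (auto simp: vec_prod_def dual_cone_def inner_vec_def intro!: sum_nonneg)
qed

lemma dual_cone_real:
  "dual_cone {0::real..} = {0..}" "dual_cone {..0::real} = {..0}" "dual_cone {0::real} = UNIV"
proof -
  have "y \<in> dual_cone {0..} \<longleftrightarrow> 0 \<le> y" for y :: real
  proof
    assume "y \<in> dual_cone {0..}"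
    then have "0 \<le> y \<bullet> 1" unfolding dual_cone_def by fastforce
    then show "0 \<le> y" by simp
  qed (simp add: dual_cone_def)
  then show "dual_cone {0::real..} = {0..}" by blast
  have "y \<in> dual_cone {..0} \<longleftrightarrow> y \<le> 0" for y :: real
  proof
    assume "y \<in> dual_cone {..0}"
    then have "0 \<le> y \<bullet> - 1" unfolding dual_cone_def by fastforce
    then show "y \<le> 0" by simp
  qed (simp add: dual_cone_def mult_nonpos_nonpos)
  then show "dual_cone {..0::real} = {..0}" by blast
qed (simp add: dual_cone_def)

text \<open>Decides the conditionals on the type of cone by which bounds are chosen below.\<close>

lemma real_cones_distinct:
  "{0::real..} \<noteq> {..0}" "{0::real..} \<noteq> {0}" "{..0::real} \<noteq> {0}"
proof -
  have *: "(1::real) \<in> {0..}" "(1::real) \<notin> {..0}" "(1::real) \<notin> {0}"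
    "(-1::real) \<in> {..0}" "(-1::real) \<notin> {0}"
    by simp_all
  show "{0::real..} \<noteq> {..0}" "{0::real..} \<noteq> {0}" "{..0::real} \<noteq> {0}"
    using * by metis+
qed

lemma mem_real_cone_iff:
  assumes "X = {0..} \<or> X = {0} \<or> X = {..0::real}"
  shows "x \<in> X \<longleftrightarrow>
    (if X = {..0} then - \<infinity> else 0) \<le> ereal x \<and> ereal x \<le> (if X = {0..} then \<infinity> else 0)"
  using assms real_cones_distinct by (elim disjE) (auto split: if_splits)

lemma mem_dual_real_cone_iff:
  assumes "X = {0..} \<or> X = {0} \<or> X = {..0::real}"
  shows "x \<in> dual_cone X \<longleftrightarrow>
    (if X = {0..} then 0 else - \<infinity>) \<le> ereal x \<and> ereal x \<le> (if X = {..0} then 0 else \<infinity>)"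
  using assms real_cones_distinct by (elim disjE) (auto simp: dual_cone_real split: if_splits)

section \<open>The injection from faces of \<open>C\<close> to faces of the box\<close>

theorem proposition5p1:
  fixes A :: "real^'n^'m" and b :: "real^'m" and K :: "'m \<Rightarrow> real set"
    and l u :: "'n \<Rightarrow> ereal" and M :: "real^'n^'n" and q :: "real^'n"
    and C B1 :: "(real^'n) set" and B2 :: "(real^'m) set"
    and M' :: "real^('n + 'm)^('n + 'm)" and q' :: "real^('n + 'm)"
    and P :: "'n avi" and Q :: "('n + 'm) mcp"
  assumes "\<And>i. row i A \<noteq> 0"
    and "\<And>i. K i \<in> {{0..}, {0}, {..0}}"
    and "\<And>j. {x::real. l j \<le> ereal x \<and> ereal x \<le> u j} \<noteq> {}"
    and "C = {z. A *v z - b \<in> vec_prod K \<and> (\<forall>j. l j \<le> ereal (z $ j) \<and> ereal (z $ j) \<le> u j)}"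
    and "P = AVI C q M"
    and "B1 = ebox l u"
    and "B2 = {y. y \<in> dual_cone (vec_prod K)}"
    and "M' = block_matrix M (- transpose A) A 0"
    and "q' = vec_join q (- b)"
    and "Q = MCP (vec_times B1 B2) q' M'"
  shows "finite (full_cells (avi_set P)) \<and> finite (full_cells (mcp_set Q)) \<and>
    card (full_cells (avi_set P)) \<le> card (full_cells (mcp_set Q))"
proof -
  define a where "a = (\<lambda>i. if K i = {..0} then - \<infinity> else 0 :: ereal)"
  define d where "d = (\<lambda>i. if K i = {0..} then \<infinity> else 0 :: ereal)"
  define a' where "a' = (\<lambda>i. if K i = {0..} then 0 else - \<infinity> :: ereal)"
  define d' where "d' = (\<lambda>i. if K i = {..0} then 0 else \<infinity> :: ereal)"
  have K: "K i = {0..} \<or> K i = {0} \<or> K i = {..0}" for i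
    using assms(2)[of i] by auto
  have Kbox: "x \<in> K i \<longleftrightarrow> a i \<le> ereal x \<and> ereal x \<le> d i" for x i
    unfolding a_def d_def by (rule mem_real_cone_iff[OF K])
  have KDbox: "x \<in> dual_cone (K i) \<longleftrightarrow> a' i \<le> ereal x \<and> ereal x \<le> d' i" for x i
    unfolding a'_def d'_def by (rule mem_dual_real_cone_iff[OF K])
  \<comment> \<open>The affine map \<open>D\<close> appends the slacks to \<open>z\<close>, so that
    \<open>C\<close> becomes the preimage of a box and \<open>ebox_extend\<close> applies to
    it.\<close>
  define D where "D z = vec_join z (A *v z - b)" for z
  have C: "z \<in> C \<longleftrightarrow> D z \<in> ebox (case_sum l a) (case_sum u d)" for z
    by (auto simp: assms(4) D_def ebox_def all_sum_iff vec_prod_def Kbox)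
  have D_extend: "D (z + e *\<^sub>R (z - w)) = D z + e *\<^sub>R (D z - D w)" for z w e
    by (simp add: D_def vec_eq_iff all_sum_iff matrix_vector_right_distrib matrix_vector_mult_scaleR
        matrix_vector_mult_diff_distrib)
  have "0 \<in> K i" for i using K[of i] by auto
  then have "dual_cone (vec_prod K) = vec_prod (\<lambda>i. dual_cone (K i))"
    by (rule dual_cone_vec_prod)
  then have "B2 = ebox a' d'"
    by (simp add: assms(7)) (simp add: vec_prod_def ebox_def KDbox)
  then have Q: "mcp_set Q = ebox (case_sum l a') (case_sum u d')" (is "_ = ebox ?a ?d")
    by (simp add: assms(6,10) vec_times_ebox)

  \<comment> \<open>The multiplier is complementary to the slack: at its bound 0 where the slack is
    nonzero, and inside the dual cone at 1 or -1 where it vanishes. For \<open>K i = {0}\<close> the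
    dual cone is the whole line, so 0 is an arbitrary choice there.\<close>
  define y where "y z = vec_join z
    (\<chi> i. if (A *v z - b) $ i \<noteq> 0 \<or> K i = {0} then 0 else if K i = {0..} then 1 else - 1)" for z
  have y: "y z \<in> ebox ?a ?d" if "z \<in> C" for z
  proof -
    have "l j \<le> ereal (z $ j)" "ereal (z $ j) \<le> u j" for j
      using that by (auto simp: assms(4))
    moreover have "a' i \<le> ereal (y z $ Inr i)" "ereal (y z $ Inr i) \<le> d' i" for i
      using K[of i] real_cones_distinct by (auto simp: y_def a'_def d'_def)
    ultimately show ?thesis
      by (simp add: ebox_def all_sum_iff) (simp add: y_def)
  qed
  have active: "ereal (D z $ k) = case_sum l a k \<longleftrightarrow> ereal (D w $ k) = case_sum l a k"
      "ereal (D z $ k) = case_sum u d k \<longleftrightarrow> ereal (D w $ k) = case_sum u d k"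
    if eq: "ebox_face ?a ?d (y z) = ebox_face ?a ?d (y w)" and "z \<in> C" "w \<in> C" for z w k
  proof -
    note y_active = ebox_face_eqD[OF eq y[OF \<open>z \<in> C\<close>] y[OF \<open>w \<in> C\<close>]]
    have "ereal (D z $ k) = case_sum l a k \<longleftrightarrow> ereal (D w $ k) = case_sum l a k" and
      "ereal (D z $ k) = case_sum u d k \<longleftrightarrow> ereal (D w $ k) = case_sum u d k"
      if "k = Inl j" for j
      using y_active[of k] that by (simp_all add: D_def y_def)
    moreover have "ereal (D z $ k) = case_sum l a k \<longleftrightarrow> ereal (D w $ k) = case_sum l a k" and
      "ereal (D z $ k) = case_sum u d k \<longleftrightarrow> ereal (D w $ k) = case_sum u d k"
      if "k = Inr i" for i
    proof -
      have "(A *v z - b) $ i \<in> K i" "(A *v w - b) $ i \<in> K i"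
        using \<open>z \<in> C\<close> \<open>w \<in> C\<close> by (simp_all only: assms(4) mem_Collect_eq vec_prod_def)
      \<comment> \<open>Here the multiplier has exactly one finite bound, 0, which is active
        precisely when the slack is nonzero.\<close>
      moreover have "(A *v z - b) $ i = 0 \<longleftrightarrow> (A *v w - b) $ i = 0" if "K i \<noteq> {0}"
        using y_active[of k] \<open>k = Inr i\<close> K[of i] real_cones_distinct that
        by (auto simp: y_def a'_def d'_def split: if_splits)
      \<comment> \<open>If \<open>K i = {0}\<close>, feasibility makes both slacks vanish.\<close>
      ultimately have "(A *v z - b) $ i = 0 \<longleftrightarrow> (A *v w - b) $ i = 0"
        by (cases "K i = {0}") auto
      \<comment> \<open>The bounds \<open>a i\<close> and \<open>d i\<close> are 0 or infinite, so
        only a zero slack can be active.\<close>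
      then show "ereal (D z $ k) = case_sum l a k \<longleftrightarrow> ereal (D w $ k) = case_sum l a k"
        "ereal (D z $ k) = case_sum u d k \<longleftrightarrow> ereal (D w $ k) = case_sum u d k"
        using \<open>k = Inr i\<close> by (auto simp: D_def a_def d_def)
    qed
    ultimately show "ereal (D z $ k) = case_sum l a k \<longleftrightarrow> ereal (D w $ k) = case_sum l a k"
      "ereal (D z $ k) = case_sum u d k \<longleftrightarrow> ereal (D w $ k) = case_sum u d k"
      by (cases k; blast)+
  qed
  \<comment> \<open>Equal active constraints allow the segment from \<open>w\<close> to be prolonged
    beyond \<open>z\<close> within \<open>C\<close>. Exchanging the two faces later turns this
    inclusion into equality.\<close>
  have sub: "G \<subseteq> F"
    if F: "F face_of C" "z \<in> rel_interior F" and G: "G face_of C" "w \<in> rel_interior G"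
      and eq: "ebox_face ?a ?d (y z) = ebox_face ?a ?d (y w)" for F G z w
  proof -
    have zF: "z \<in> F" and zC: "z \<in> C" and wC: "w \<in> C"
      using F G face_of_imp_subset rel_interior_subset by blast+
    obtain e where "e > 0" "D z + e *\<^sub>R (D z - D w) \<in> ebox (case_sum l a) (case_sum u d)"
      using ebox_extend[of "D z" _ _ "D w"] zC wC C active[OF eq zC wC] by metis
    then have "e > 0" "z + e *\<^sub>R (z - w) \<in> C"
      by (simp_all add: C D_extend)
    then show ?thesis
      using face_of_subset_extend F(1) G zF by blast
  qed

  define faces where "faces = {F. F face_of C \<and> F \<noteq> {}}"
  define pt where "pt F = (SOME z. z \<in> rel_interior F)" for F :: "(real^'n) set"
  have pt: "pt F \<in> rel_interior F" if "F \<in> faces" for F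
    using that unfolding pt_def faces_def
    by (metis (mono_tags) face_of_imp_convex mem_Collect_eq rel_interior_eq_empty some_in_eq)
  have inj: "inj_on (\<lambda>F. ebox_face ?a ?d (y (pt F))) faces"
  proof (rule inj_onI)
    fix F G assume FG: "F \<in> faces" "G \<in> faces"
      and eq: "ebox_face ?a ?d (y (pt F)) = ebox_face ?a ?d (y (pt G))"
    then show "F = G"
      using sub[of F "pt F" G "pt G"] sub[of G "pt G" F "pt F"] pt by (auto simp: faces_def)
  qed
  have into: "(\<lambda>F. ebox_face ?a ?d (y (pt F))) ` faces \<subseteq> {H. H face_of mcp_set Q \<and> H \<noteq> {}}"
  proof (rule image_subsetI)
    fix F assume F: "F \<in> faces"
    then have "pt F \<in> C"
      using pt[OF F] rel_interior_subset face_of_imp_subset unfolding faces_def by blast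
    then show "ebox_face ?a ?d (y (pt F)) \<in> {H. H face_of mcp_set Q \<and> H \<noteq> {}}"
      using ebox_face_face_of[OF y] mem_ebox_face[OF y] by (auto simp: Q)
  qed
  \<comment> \<open>Finiteness of the faces of the box passes to the faces of \<open>C\<close>
    through the injection.\<close>
  have fin: "finite {H. H face_of mcp_set Q \<and> H \<noteq> {}}"
    using finite_polyhedron_faces[OF polyhedron_ebox] unfolding Q by (rule rev_finite_subset) auto
  have "avi_set P = C" by (simp add: assms(5))
  then show ?thesis
    using fin card_inj_on_le[OF inj into fin] inj_on_finite[OF inj into fin]
    by (simp add: finite_full_cells_iff card_full_cells faces_def)
qed
end
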